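(* Let $k\ge1$ be an integer and let $P$ be a $k$-polymatroid. (i) If $k$ is odd, then $(-1)^{r(P)}\,T_k(P;x+1,0)=\chi(P;-x)$. (ii) If $k$ is even, then for any $\eta\in\mathbb{C}$ such that $\eta^k=-1$, we have $(-\eta)^{r(P)}\,T_k(P;1+x\eta^{-1},1-\eta)=\chi(P;-x)$.
   Context: A polymatroid is a pair $P=(E,r)$ with $E$ a finite set and $r:2^E\to\mathbb{Z}$ such that $r(\emptyset)=0$, $r(A)\le r(B)$ whenever $A\subseteq B$, and $r(A)+r(B)\ge r(A\cup B)+r(A\cap B)$ for all $A,B\subseteq E$. It is a $k$-polymatroid if $r(\{e\})\le k$ for all $e\in E$. Write $r(P)=r(E)$. $k$-polymatroid Tutte polynomial: $T_k(P;x,y)=\sum_{A\subseteq E}(x-1)^{r(E)-r(A)}(y-1)^{k|A|-r(A)}$. Characteristic polynomial: $\chi(P;x)=\sum_{A\subseteq E}(-1)^{|A|}x^{r(P)-r(A)}$. *)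

theory Defs
  imports Complex_Main "HOL-Computational_Algebra.Polynomial"
begin

locale polymatroid =
  fixes E :: "'e set" and r :: "'e set \<Rightarrow> int"
  assumes finite_ground: "finite E"
    and rank_empty: "r {} = 0"
    and rank_mono: "\<And>A B. A \<subseteq> B \<Longrightarrow> B \<subseteq> E \<Longrightarrow> r A \<le> r B"
    and rank_submodular:
      "\<And>A B. A \<subseteq> E \<Longrightarrow> B \<subseteq> E \<Longrightarrow> r A + r B \<ge> r (A \<union> B) + r (A \<inter> B)"

locale k_polymatroid = polymatroid E r
  for E :: "'e set" and r :: "'e set \<Rightarrow> int" +
  fixes k :: nat
  assumes rank_singleton: "\<And>e. e \<in> E \<Longrightarrow> r {e} \<le> int k"

text \<open>
  Polynomials in \<open>x, y\<close> over the integers are represented by \<^typ>\<open>int poly poly\<close>: the outer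
  variable is \<open>x\<close>, the coefficients are polynomials in \<open>y\<close>. The truncation by \<^const>\<open>nat\<close> in
  the exponents below is harmless: for a \<open>k\<close>-polymatroid all of them are nonnegative, see
  \<open>rank_le_ground\<close> and \<open>rank_le_card\<close>.
\<close>

definition tutte_poly :: "nat \<Rightarrow> 'e set \<Rightarrow> ('e set \<Rightarrow> int) \<Rightarrow> int poly poly" where
  "tutte_poly k E r =
     (\<Sum>A\<in>Pow E. ([:0, 1:] - 1) ^ nat (r E - r A) *
                 ([:[:0, 1:]:] - 1) ^ nat (int k * int (card A) - r A))"

definition characteristic_poly :: "'e set \<Rightarrow> ('e set \<Rightarrow> int) \<Rightarrow> int poly" where
  "characteristic_poly E r = (\<Sum>A\<in>Pow E. (-1) ^ card A * [:0, 1:] ^ nat (r E - r A))"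

text \<open>
  Substitution into integer polynomials, with values in an arbitrary commutative ring; taking a
  polynomial ring as target expresses substitution of polynomials.
\<close>

definition subst1 :: "int poly \<Rightarrow> 'a::comm_ring_1 \<Rightarrow> 'a" where
  "subst1 p a = poly (map_poly of_int p) a"

definition subst2 :: "int poly poly \<Rightarrow> 'a::comm_ring_1 \<Rightarrow> 'a \<Rightarrow> 'a" where
  "subst2 p a b = poly (map_poly (\<lambda>c. subst1 c b) p) a"

lemma (in polymatroid) rank_le_ground: "A \<subseteq> E \<Longrightarrow> r A \<le> r E"
  by (rule rank_mono) auto

lemma (in polymatroid) rank_nonneg: "A \<subseteq> E \<Longrightarrow> 0 \<le> r A"
  using rank_mono[of "{}" A] rank_empty by simp

lemma (in k_polymatroid) rank_le_card:
  assumes "A \<subseteq> E"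
  shows "r A \<le> int k * int (card A)"
proof -
  have "finite A" using assms finite_ground by (rule finite_subset)
  then show ?thesis using assms
  proof (induction A rule: finite_induct)
    case empty
    then show ?case by (simp add: rank_empty)
  next
    case (insert e A)
    have "r ({e} \<union> A) + r ({e} \<inter> A) \<le> r {e} + r A"
      using insert.prems by (intro rank_submodular) auto
    moreover have "{e} \<inter> A = {}" using insert.hyps by auto
    ultimately have "r (insert e A) \<le> r {e} + r A" by (simp add: rank_empty)
    with insert rank_singleton[of e] show ?case by (simp add: algebra_simps)
  qed
qed

lemma poly_map_poly_hom:
  fixes h :: "'a::comm_ring_1 \<Rightarrow> 'b::comm_ring_1"
  assumes h0: "h 0 = 0" and h1: "h 1 = 1"
    and hadd: "\<And>x y. h (x + y) = h x + h y" and hmult: "\<And>x y. h (x * y) = h x * h y"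
  shows "poly (map_poly h (p + q)) a = poly (map_poly h p) a + poly (map_poly h q) a"
    and "poly (map_poly h (p * q)) a = poly (map_poly h p) a * poly (map_poly h q) a"
    and "poly (map_poly h 1) a = 1"
proof -
  have add: "map_poly h (p + q) = map_poly h p + map_poly h q" for p q
    by (rule poly_eqI) (simp add: coeff_map_poly h0 hadd)
  have smult: "map_poly h (smult c p) = smult (h c) (map_poly h p)" for c p
    by (rule poly_eqI) (simp add: coeff_map_poly h0 hmult)
  have pCons: "map_poly h (pCons c p) = pCons (h c) (map_poly h p)" for c p
    by (rule poly_eqI) (simp add: coeff_map_poly h0 coeff_pCons split: nat.split)
  show "poly (map_poly h (p + q)) a = poly (map_poly h p) a + poly (map_poly h q) a"
    by (simp add: add)
  show "poly (map_poly h (p * q)) a = poly (map_poly h p) a * poly (map_poly h q) a"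
    by (induction p) (simp_all add: add smult pCons h0 algebra_simps)
  show "poly (map_poly h 1) a = 1"
    by (simp add: h1)
qed

lemma subst1_simps [simp]:
  "subst1 0 a = 0" "subst1 1 a = 1" "subst1 (p + q) a = subst1 p a + subst1 q a"
  "subst1 (p * q) a = subst1 p a * subst1 q a" "subst1 [:0, 1:] a = a"
  by (simp_all add: subst1_def poly_map_poly_hom map_poly_pCons)

lemma subst2_simps [simp]:
  "subst2 0 a b = 0" "subst2 1 a b = 1" "subst2 (p + q) a b = subst2 p a b + subst2 q a b"
  "subst2 (p * q) a b = subst2 p a b * subst2 q a b"
  "subst2 [:0, 1:] a b = a" "subst2 [:[:0, 1:]:] a b = b"
  by (simp_all add: subst2_def poly_map_poly_hom map_poly_pCons)

lemma subst1_uminus [simp]: "subst1 (- p) a = - subst1 p a"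
  using subst1_simps(3)[of p "- p" a] by (simp add: eq_neg_iff_add_eq_0 add.commute)

lemma subst2_uminus [simp]: "subst2 (- p) a b = - subst2 p a b"
  using subst2_simps(3)[of p "- p" a b] by (simp add: eq_neg_iff_add_eq_0 add.commute)

lemma subst_power [simp]:
  "subst1 (p ^ n) a = subst1 p a ^ n" "subst2 (q ^ n) a b = subst2 q a b ^ n"
  by (induction n) simp_all

lemma subst_sum [simp]:
  "subst1 (\<Sum>i\<in>I. p i) a = (\<Sum>i\<in>I. subst1 (p i) a)"
  "subst2 (\<Sum>i\<in>I. q i) a b = (\<Sum>i\<in>I. subst2 (q i) a b)"
  by (induction I rule: infinite_finite_induct) simp_all

lemma subst2_diff: "subst2 (p - q) a b = subst2 p a b - subst2 q a b"
  using subst2_simps(3)[of p "- q" a b] by simp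

lemma subst2_tutte_poly:
  "subst2 (tutte_poly k E r) a b =
     (\<Sum>A\<in>Pow E. (a - 1) ^ nat (r E - r A) * (b - 1) ^ nat (int k * int (card A) - r A))"
  by (simp only: tutte_poly_def subst_sum subst2_simps subst_power subst2_diff)

lemma subst1_characteristic_poly:
  "subst1 (characteristic_poly E r) a = (\<Sum>A\<in>Pow E. (-1) ^ card A * a ^ nat (r E - r A))"
  by (simp only: characteristic_poly_def subst_sum subst1_simps subst_power subst1_uminus)

end

theory Submission imports Defs begin

text \<open>
  Scaling by \<open>c ^ r E = c ^ (r E - r A) * c ^ r A\<close> turns the first factor of the summand of \<open>A\<close> in
  \<open>T\<^sub>k(P; 1 + z, 1 + c)\<close> into \<open>(c * z) ^ (r E - r A)\<close> and the second into \<open>c ^ (k * card A)\<close>. The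
  result is the summand of \<open>A\<close> in \<open>\<chi>(P; c * z)\<close> as soon as \<open>c ^ k = -1\<close>. Part (i) is \<open>c = -1\<close>,
  \<open>z = x\<close>, and part (ii) is \<open>c = -\<eta>\<close>, \<open>z = x / \<eta>\<close>.
\<close>

context k_polymatroid
begin

lemma power_rank_mult_tutte_summand:
  fixes c z :: "'a::comm_ring_1"
  assumes "A \<subseteq> E"
  shows "c ^ nat (r E) * (z ^ nat (r E - r A) * c ^ nat (int k * int (card A) - r A))
           = (c ^ k) ^ card A * (c * z) ^ nat (r E - r A)"
proof -
  note bounds = rank_nonneg[OF assms] rank_le_ground[OF assms] rank_le_card[OF assms]
  have rank_split: "nat (r E) = nat (r E - r A) + nat (r A)"
    using bounds by simp
  have "nat (r A) + nat (int k * int (card A) - r A) = k * card A"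
    using bounds by (simp flip: nat_add_distrib of_nat_mult)
  then have second_factor:
    "c ^ nat (r A) * c ^ nat (int k * int (card A) - r A) = (c ^ k) ^ card A"
    by (simp flip: power_add power_mult)
  show ?thesis
    unfolding rank_split power_add power_mult_distrib second_factor[symmetric]
    by (simp only: ac_simps)
qed

lemma power_rank_mult_subst2_tutte_poly:
  fixes c z :: "'a::comm_ring_1"
  shows "c ^ nat (r E) * subst2 (tutte_poly k E r) (1 + z) (1 + c)
           = (\<Sum>A\<in>Pow E. (c ^ k) ^ card A * (c * z) ^ nat (r E - r A))"
  by (simp add: subst2_tutte_poly sum_distrib_left power_rank_mult_tutte_summand)

corollary tutte_poly_eq_characteristic_poly:
  fixes c z :: "'a::comm_ring_1"
  assumes "c ^ k = -1"
  shows "c ^ nat (r E) * subst2 (tutte_poly k E r) (1 + z) (1 + c)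
           = subst1 (characteristic_poly E r) (c * z)"
  by (simp add: power_rank_mult_subst2_tutte_poly subst1_characteristic_poly assms)

corollary tutte_poly_eq_characteristic_poly_odd:
  fixes a :: "'a::comm_ring_1"
  assumes "odd k"
  shows "(-1) ^ nat (r E) * subst2 (tutte_poly k E r) (a + 1) 0
           = subst1 (characteristic_poly E r) (- a)"
  using tutte_poly_eq_characteristic_poly[of "-1" a] assms by (simp add: add.commute)

corollary tutte_poly_eq_characteristic_poly_even:
  fixes a \<eta> \<eta>' :: "'a::comm_ring_1"
  assumes "even k" and "\<eta> ^ k = -1" and "\<eta> * \<eta>' = 1"
  shows "(- \<eta>) ^ nat (r E) * subst2 (tutte_poly k E r) (1 + \<eta>' * a) (1 - \<eta>)
           = subst1 (characteristic_poly E r) (- a)"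
proof -
  have "(- \<eta>) ^ k = -1"
    using assms by simp
  moreover have "- \<eta> * (\<eta>' * a) = - a"
    using assms by (simp flip: mult.assoc)
  ultimately show ?thesis
    using tutte_poly_eq_characteristic_poly[of "- \<eta>" "\<eta>' * a"] by simp
qed

end

theorem proposition3p6:
  fixes E :: "'e set" and r :: "'e set \<Rightarrow> int" and k :: nat
  assumes "k \<ge> 1" and "k_polymatroid E r k"
  shows "(odd k \<longrightarrow>
            (-1) ^ nat (r E) * subst2 (tutte_poly k E r) ([:0, 1:] + 1) 0
              = subst1 (characteristic_poly E r) (- [:0, 1:] :: int poly)) \<and>
         (even k \<longrightarrow>
            (\<forall>\<eta>::complex. \<eta> ^ k = -1 \<longrightarrow>
              smult ((- \<eta>) ^ nat (r E))
                (subst2 (tutte_poly k E r) (1 + smult (inverse \<eta>) [:0, 1:]) [:1 - \<eta>:])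
              = subst1 (characteristic_poly E r) (- [:0, 1:] :: complex poly)))"
proof (intro conjI impI allI)
  interpret k_polymatroid E r k by fact
  show "(-1) ^ nat (r E) * subst2 (tutte_poly k E r) ([:0, 1:] + 1) 0
          = subst1 (characteristic_poly E r) (- [:0, 1:] :: int poly)" if "odd k"
    using that by (rule tutte_poly_eq_characteristic_poly_odd)
  show "smult ((- \<eta>) ^ nat (r E))
          (subst2 (tutte_poly k E r) (1 + smult (inverse \<eta>) [:0, 1:]) [:1 - \<eta>:])
        = subst1 (characteristic_poly E r) (- [:0, 1:] :: complex poly)"
    if "even k" and root: "\<eta> ^ k = -1" for \<eta> :: complex
  proof -
    have "\<eta> \<noteq> 0"
      using root \<open>k \<ge> 1\<close> by (auto simp: power_0_left)
    then have "[:\<eta>:] * [:inverse \<eta>:] = 1"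
      by (simp add: one_pCons)
    moreover have "[:\<eta>:] ^ k = -1"
      using root by (simp add: poly_const_pow one_pCons)
    ultimately show ?thesis
      using tutte_poly_eq_characteristic_poly_even
        [OF \<open>even k\<close>, of "[:\<eta>:]" "[:inverse \<eta>:]" "[:0, 1:]"]
      by (simp add: poly_const_pow one_pCons)
  qed
qed

end
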